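(* Let $(X,d)$ be a nonempty complete metric space and let $T:X\to X$ be a logically contractive mapping with constant $\lambda\in(0,1)$ and event sequence $n_1<n_2<n_3<\cdots$. Then: 1. $T$ has a unique fixed point $z\in X$. 2. For every $x\in X$, the sequence $T^n x$ converges to $z$ as $n\to\infty$. 3. For every $x\in X$ and all $k\ge 1$, $d(T^{n_k}x,z)\le \lambda^k\, d(x,z)$.
   Context: For a self-map $T$ of a metric space $(X,d)$ and a positive integer $n$, $T^n$ denotes the $n$-fold composition (so $T^1=T$). For a self-map $S$ of $X$, $\mathrm{Lip}(S):=\sup_{x\ne y}\frac{d(Sx,Sy)}{d(x,y)}$ (equal to $0$ if $X$ has a single point). $T$ is nonexpansive if $\mathrm{Lip}(T)\le 1$. Definition: $T:X\to X$ is logically contractive (with constant $\lambda$ and event sequence $(n_k)$) if $T$ is nonexpansive and there exist a constant $\lambda\in(0,1)$ and a strictly increasing sequence of positive integers $n_1<n_2<n_3<\cdots$ such that $\mathrm{Lip}(T^{n_k})\le\lambda^k$ for all $k\ge 1$. *)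

theory Defs
  imports "HOL-Analysis.Analysis"
begin

text \<open>
  The Lipschitz constant takes values in the extended nonnegative reals, since the supremum need
  not be finite. Here the supremum of the empty set is 0, which covers one-point spaces. The
  arguments \<open>X\<close> and \<open>d\<close> are the carrier and the distance as in the locale \<^locale>\<open>Metric_space\<close>, and
  only the values of \<open>S\<close> on \<open>X\<close> matter.
\<close>

definition Lip :: "'a set \<Rightarrow> ('a \<Rightarrow> 'a \<Rightarrow> real) \<Rightarrow> ('a \<Rightarrow> 'a) \<Rightarrow> ennreal" where
  "Lip X d S = (SUP (x, y) \<in> {(x, y). x \<in> X \<and> y \<in> X \<and> x \<noteq> y}. ennreal (d (S x) (S y) / d x y))"

definition nonexpansive :: "'a set \<Rightarrow> ('a \<Rightarrow> 'a \<Rightarrow> real) \<Rightarrow> ('a \<Rightarrow> 'a) \<Rightarrow> bool" where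
  "nonexpansive X d T \<longleftrightarrow> Lip X d T \<le> 1"

text \<open>
  The event sequence is \<open>n 1 < n 2 < n 3 < \<dots>\<close>; the value \<open>n 0\<close> is unconstrained.
\<close>

definition logically_contractive ::
  "'a set \<Rightarrow> ('a \<Rightarrow> 'a \<Rightarrow> real) \<Rightarrow> ('a \<Rightarrow> 'a) \<Rightarrow> real \<Rightarrow> (nat \<Rightarrow> nat) \<Rightarrow> bool" where
  "logically_contractive X d T c n \<longleftrightarrow>
     nonexpansive X d T \<and> 0 < c \<and> c < 1 \<and>
     strict_mono_on {1..} n \<and> (\<forall>k\<ge>1. n k > 0) \<and>
     (\<forall>k\<ge>1. Lip X d (T ^^ n k) \<le> ennreal (c ^ k))"

end

theory Submission
  imports Defs
begin

text \<open>
  The first event already makes the iterate \<open>T ^^ n 1\<close> a contraction with factor \<open>c\<close>, so Banach's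
  theorem gives it a unique fixed point \<open>z\<close>. Since \<open>T\<close> commutes with its iterates, \<open>T z\<close> is again
  fixed by \<open>T ^^ n 1\<close>, so uniqueness forces \<open>T z = z\<close>; conversely every fixed point of \<open>T\<close> is fixed
  by \<open>T ^^ n 1\<close> and hence is \<open>z\<close>. Comparing an arbitrary orbit with the constant orbit of \<open>z\<close> at the
  \<open>k\<close>-th event gives the factor \<open>c ^ k\<close>. Nonexpansiveness makes the distance to \<open>z\<close> nonincreasing
  along each orbit, so the bound reached at the \<open>k\<close>-th event persists at all later times; as
  \<open>c ^ k\<close> tends to 0, the whole orbit converges and not only the subsequence of events.
\<close>

lemma (in Metric_space) Lip_le_imp_lipschitz:
  assumes "Lip M d S \<le> ennreal L" "0 \<le> L" "x \<in> M" "y \<in> M" "S \<in> M \<rightarrow> M"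
  shows "d (S x) (S y) \<le> L * d x y"
proof (cases "x = y")
  case True
  moreover have "S y \<in> M"
    using assms(4,5) by blast
  ultimately show ?thesis
    using assms(4) by simp
next
  case False
  have "ennreal (d (S x) (S y) / d x y) \<le> Lip M d S"
    unfolding Lip_def using assms False by (intro SUP_upper2[of "(x, y)"]) auto
  then have "d (S x) (S y) / d x y \<le> L"
    using assms(1,2) ennreal_le_iff order_trans by blast
  moreover have "0 < d x y"
    using False assms(3,4) by simp
  ultimately show ?thesis
    by (simp add: pos_divide_le_eq)
qed

lemma funpow_in_funcset:
  assumes "T \<in> X \<rightarrow> X"
  shows "T ^^ m \<in> X \<rightarrow> X"
  using assms by (induction m) auto

lemma funpow_fixpoint:
  assumes "T z = z"
  shows "(T ^^ m) z = z"
  using assms by (induction m) auto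

text \<open>
  A contraction factor for some iterate suffices for a unique fixed point of the map itself: the map
  sends fixed points of its iterate to fixed points of that iterate, and there is only one.
\<close>

lemma (in Metric_space) unique_fixpoint_of_contractive_iterate:
  assumes "mcomplete" "M \<noteq> {}" "T \<in> M \<rightarrow> M" "c < 1"
    and contr: "\<And>x y. x \<in> M \<Longrightarrow> y \<in> M \<Longrightarrow> d ((T ^^ N) x) ((T ^^ N) y) \<le> c * d x y"
  shows "\<exists>!z. z \<in> M \<and> T z = z"
proof -
  have maps: "T ^^ N \<in> M \<rightarrow> M"
    using assms(3) by (rule funpow_in_funcset)
  have unique: "x = y" if "x \<in> M" "y \<in> M" "(T ^^ N) x = x" "(T ^^ N) y = y" for x y
  proof (rule ccontr)
    assume "x \<noteq> y"
    then have "0 < d x y"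
      using that by simp
    moreover have "d x y \<le> c * d x y"
      using contr[of x y] that by simp
    ultimately show False
      using \<open>c < 1\<close> by (simp add: mult_le_cancel_right1)
  qed
  obtain z where z: "z \<in> M" "(T ^^ N) z = z"
    using Banach_fixedpoint_thm[OF assms(1,2) maps \<open>c < 1\<close>] contr by blast
  have "(T ^^ N) (T z) = T z"
    by (metis funpow_swap1 z(2))
  then have "T z = z"
    using unique z assms(3) by blast
  then show ?thesis
    using z(1) unique funpow_fixpoint[of T _ N] by (metis (no_types))
qed

theorem theorem2p2:
  fixes X :: "'a set" and d :: "'a \<Rightarrow> 'a \<Rightarrow> real" and T :: "'a \<Rightarrow> 'a"
    and c :: real and n :: "nat \<Rightarrow> nat"
  assumes "Metric_space X d"
    and "Metric_space.mcomplete X d"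
    and "X \<noteq> {}"
    and "T \<in> X \<rightarrow> X"
    and "logically_contractive X d T c n"
  shows "\<exists>z\<in>X.
    (T z = z \<and> (\<forall>y\<in>X. T y = y \<longrightarrow> y = z)) \<and>
    (\<forall>x\<in>X. limitin (Metric_space.mtopology X d) (\<lambda>m. (T ^^ m) x) z sequentially) \<and>
    (\<forall>x\<in>X. \<forall>k\<ge>1. d ((T ^^ n k) x) z \<le> c ^ k * d x z)"
proof -
  interpret Metric_space X d by fact
  have c: "0 < c" "c < 1" and Lip_T: "Lip X d T \<le> ennreal 1"
    and Lip_event: "\<And>k. k \<ge> 1 \<Longrightarrow> Lip X d (T ^^ n k) \<le> ennreal (c ^ k)"
    using assms(5) by (auto simp: logically_contractive_def nonexpansive_def)
  have iter: "(T ^^ m) x \<in> X" if "x \<in> X" for m x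
    using funpow_in_funcset[OF assms(4)] that by blast
  have event: "d ((T ^^ n k) x) ((T ^^ n k) y) \<le> c ^ k * d x y"
    if "k \<ge> 1" "x \<in> X" "y \<in> X" for k x y
    using Lip_le_imp_lipschitz[OF Lip_event] that c funpow_in_funcset[OF assms(4)] by simp
  have "\<exists>!z. z \<in> X \<and> T z = z"
    using unique_fixpoint_of_contractive_iterate[OF assms(2-4) c(2), of "n 1"] event[of 1] by simp
  then obtain z where z: "z \<in> X" "T z = z" and uniq: "\<And>y. y \<in> X \<Longrightarrow> T y = y \<Longrightarrow> y = z"
    by blast
  have event_z: "d ((T ^^ n k) x) z \<le> c ^ k * d x z" if "x \<in> X" "k \<ge> 1" for x k
    using event[OF that(2,1) z(1)] funpow_fixpoint[of T z, OF z(2)] by simp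
  have "limitin mtopology (\<lambda>m. (T ^^ m) x) z sequentially" if x: "x \<in> X" for x
  proof -
    have "d ((T ^^ Suc m) x) z \<le> d ((T ^^ m) x) z" for m
      using Lip_le_imp_lipschitz[OF Lip_T _ iter[OF x] z(1) assms(4)] z(2) by simp
    then have antimono: "d ((T ^^ m) x) z \<le> d ((T ^^ l) x) z" if "l \<le> m" for l m
      using that by (rule lift_Suc_antimono_le)
    have "\<exists>N. \<forall>m\<ge>N. (T ^^ m) x \<in> X \<and> d ((T ^^ m) x) z < e" if e: "e > 0" for e
    proof -
      have "(\<lambda>k. c ^ k * d x z) \<longlonglongrightarrow> 0"
        using c by (auto intro!: tendsto_mult_left_zero LIMSEQ_power_zero)
      then have "eventually (\<lambda>k. c ^ k * d x z < e) sequentially"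
        using e by (rule order_tendstoD)
      then obtain K where "\<And>k. k \<ge> K \<Longrightarrow> c ^ k * d x z < e"
        by (auto simp: eventually_sequentially)
      then obtain k where k: "k \<ge> 1" "c ^ k * d x z < e"
        by (meson max.cobounded1 max.cobounded2)
      have "d ((T ^^ m) x) z < e" if "m \<ge> n k" for m
        using antimono[OF that] event_z[OF x k(1)] k(2) by linarith
      then show ?thesis
        using iter[OF x] by blast
    qed
    then show ?thesis
      unfolding limit_metric_sequentially using z(1) by blast
  qed
  then show ?thesis
    using z uniq event_z by blast
qed

end
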